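(* Let $\mathcal{U}$ be an ultrafilter on a set $\mathcal{I}$, let $\mathfrak{X}_i=(X_i,\Sigma_i,\nu_i)$, $i\in\mathcal{I}$, be probability spaces, and let $\mathfrak{X}=(X,\Sigma,\nu)=\mathcal{U}\lim\mathfrak{X}_i$ be their ultralimit. Let $f_i$ be measurable functions on $\mathfrak{X}_i$. Assume that there is $\rho\in\mathbf{M}$ with $f_i\in\mathcal{C}_\rho(\mathfrak{X}_i)$ for all $i$ and $\sup_i\|f_i\|_{\mathcal{C}_\rho(\mathfrak{X}_i)}<\infty$. Then $\mathcal{U}\lim f_i\in L^1(\mathfrak{X})$ and $$\int_X\mathcal{U}\lim f_i\,d\nu=\mathcal{U}\lim\int_{X_i}f_i\,d\nu_i.$$
   Context: For numbers $x_i\in[-\infty,\infty]$, $\mathcal{U}\lim x_i$ is the unique $x\in[-\infty,\infty]$ such that $\{i:x_i\in W\}\in\mathcal{U}$ for every neighbourhood $W$ of $x$. Ultralimit of probability spaces: $X=\prod_iX_i/\!\sim$ with $(x_i)\sim(y_i)$ iff $\{i:x_i=y_i\}\in\mathcal{U}$; $[x_i]$ is the class of $(x_i)$. For $A_i\in\Sigma_i$, $\mathcal{U}\lim A_i=\{[x_i]:\{i:x_i\in A_i\}\in\mathcal{U}\}$; these sets form an algebra, $\Sigma$ is the $\sigma$-algebra it generates, and $\nu$ is the unique probability measure on $\Sigma$ with $\nu(\mathcal{U}\lim A_i)=\mathcal{U}\lim\nu_i(A_i)$. For functions $f_i:X_i\to[-\infty,\infty]$, $(\mathcal{U}\lim f_i)([x_i])=\mathcal{U}\lim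 f_i(x_i)$. The space of majorants $\mathbf{M}$ is the set of concave functions $\rho:[0,1]\to[0,1]$ with $\rho(0)=\rho(0^+)=0$ and $\rho(1)=1$. For a probability space $\mathfrak{X}=(X,\Sigma,\nu)$ and $\rho\in\mathbf{M}$, $\mathcal{C}_\rho(\mathfrak{X})$ is the space of $f\in L^1(\mathfrak{X})$ (mod a.e. equality) with $$\|f\|_{\mathcal{C}_\rho(\mathfrak{X})}=\sup_{A\in\Sigma,\ \nu(A)\ne0}\frac1{\rho(\nu(A))}\int_A|f|\,d\nu<\infty.$$ *)

theory Defs
  imports "HOL-Probability.Probability"
begin

section \<open>Ultrafilters\<close>

text \<open>
  An ultrafilter on a set \<open>I\<close> is represented by a filter on the ambient type that contains \<open>I\<close>;
  the statement \<open>{i. P i} \<in> U\<close> is written \<open>eventually P U\<close>. The limit of a family along \<open>U\<close> is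
  \<^term>\<open>Lim U\<close>; it exists and is unique in the compact Hausdorff types \<^typ>\<open>ereal\<close> and
  \<^typ>\<open>ennreal\<close>, the latter carrying the topology of the subspace of nonnegative elements of the former.
\<close>

definition ultrafilter_on :: "'i set \<Rightarrow> 'i filter \<Rightarrow> bool" where
  "ultrafilter_on I U \<longleftrightarrow>
     U \<noteq> bot \<and> eventually (\<lambda>i. i \<in> I) U \<and>
     (\<forall>P. eventually P U \<or> eventually (\<lambda>i. \<not> P i) U)"

section \<open>Ultralimits of probability spaces\<close>

definition ulim_rel ::
    "'i filter \<Rightarrow> 'i set \<Rightarrow> ('i \<Rightarrow> 'a measure) \<Rightarrow> (('i \<Rightarrow> 'a) \<times> ('i \<Rightarrow> 'a)) set" where
  "ulim_rel U I M =
     {(x, y). x \<in> (\<Pi>\<^sub>E i\<in>I. space (M i)) \<and> y \<in> (\<Pi>\<^sub>E i\<in>I. space (M i)) \<and>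
              eventually (\<lambda>i. x i = y i) U}"

definition ulim_space :: "'i filter \<Rightarrow> 'i set \<Rightarrow> ('i \<Rightarrow> 'a measure) \<Rightarrow> ('i \<Rightarrow> 'a) set set" where
  "ulim_space U I M = (\<Pi>\<^sub>E i\<in>I. space (M i)) // ulim_rel U I M"

definition ulim_set ::
    "'i filter \<Rightarrow> 'i set \<Rightarrow> ('i \<Rightarrow> 'a measure) \<Rightarrow> ('i \<Rightarrow> 'a set) \<Rightarrow> ('i \<Rightarrow> 'a) set set" where
  "ulim_set U I M A =
     {ulim_rel U I M `` {x} | x. x \<in> (\<Pi>\<^sub>E i\<in>I. space (M i)) \<and> eventually (\<lambda>i. x i \<in> A i) U}"

text \<open>
  The underlying \<open>\<sigma>\<close>-algebra is generated by the sets \<^term>\<open>ulim_set U I M A\<close>, where \<open>A\<close> ranges over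
  the families of measurable sets; \<^const>\<open>extend_measure\<close> takes the measure on it with the prescribed
  values on these generators. That measure exists by Caratheodory's theorem and is unique, because
  the generators form an algebra and the whole space has measure 1.
\<close>

definition ulim_measure ::
    "'i filter \<Rightarrow> 'i set \<Rightarrow> ('i \<Rightarrow> 'a measure) \<Rightarrow> ('i \<Rightarrow> 'a) set measure" where
  "ulim_measure U I M =
     extend_measure (ulim_space U I M) (\<Pi>\<^sub>E i\<in>I. sets (M i)) (ulim_set U I M)
       (\<lambda>A. Lim U (\<lambda>i. emeasure (M i) (A i)))"

text \<open>
  The image below is a singleton for every class \<open>c\<close> in \<^term>\<open>ulim_space U I M\<close>, since equivalent
  families give the same limit.
\<close>

definition ulim_fun :: "'i filter \<Rightarrow> ('i \<Rightarrow> 'a \<Rightarrow> ereal) \<Rightarrow> ('i \<Rightarrow> 'a) set \<Rightarrow> ereal" where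
  "ulim_fun U f c = the_elem ((\<lambda>x. Lim U (\<lambda>i. f i (x i))) ` c)"

section \<open>Integration of functions with values in the extended reals\<close>

text \<open>
  The Bochner integral is restricted to Banach-space valued functions, so integrability and the
  integral of extended real functions are defined here. Note that \<^const>\<open>e2ennreal\<close> maps negative
  numbers to 0, so that \<open>e2ennreal (f x)\<close> and \<open>e2ennreal (- f x)\<close> are the positive and negative
  parts of \<open>f x\<close>. Elements of \<open>L\<^sup>1\<close> are represented by functions; everything below depends on \<open>f\<close>
  only up to equality almost everywhere.
\<close>

definition L1_space :: "'a measure \<Rightarrow> ('a \<Rightarrow> ereal) set" where
  "L1_space M = {f \<in> borel_measurable M. (\<integral>\<^sup>+x. e2ennreal \<bar>f x\<bar> \<partial>M) < \<infinity>}"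

definition ereal_integral :: "'a measure \<Rightarrow> ('a \<Rightarrow> ereal) \<Rightarrow> ereal" where
  "ereal_integral M f =
     enn2ereal (\<integral>\<^sup>+x. e2ennreal (f x) \<partial>M) - enn2ereal (\<integral>\<^sup>+x. e2ennreal (- f x) \<partial>M)"

lemma ereal_in_L1_space_iff:
  fixes g :: "'a \<Rightarrow> real"
  shows "(\<lambda>x. ereal (g x)) \<in> L1_space M \<longleftrightarrow> integrable M g"
  by (auto simp: L1_space_def integrable_iff_bounded e2ennreal_ereal)

lemma ereal_integral_ereal:
  fixes g :: "'a \<Rightarrow> real"
  assumes "integrable M g"
  shows "ereal_integral M (\<lambda>x. ereal (g x)) = ereal (integral\<^sup>L M g)"
proof -
  have fin: "(\<integral>\<^sup>+x. ennreal (g x) \<partial>M) < \<infinity>" "(\<integral>\<^sup>+x. ennreal (- g x) \<partial>M) < \<infinity>"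
    using assms by (auto simp: real_integrable_def top.not_eq_extremum)
  then show ?thesis
    using real_lebesgue_integral_def[OF assms]
    by (cases "\<integral>\<^sup>+x. ennreal (g x) \<partial>M"; cases "\<integral>\<^sup>+x. ennreal (- g x) \<partial>M")
       (auto simp: ereal_integral_def e2ennreal_ereal enn2ereal_ennreal)
qed

section \<open>Majorants and the associated function spaces\<close>

definition majorants :: "(real \<Rightarrow> real) set" where
  "majorants = {\<rho>. concave_on {0..1} \<rho> \<and> \<rho> ` {0..1} \<subseteq> {0..1} \<and>
                   \<rho> 0 = 0 \<and> (\<rho> \<longlongrightarrow> 0) (at_right 0) \<and> \<rho> 1 = 1}"

definition C_norm :: "(real \<Rightarrow> real) \<Rightarrow> 'a measure \<Rightarrow> ('a \<Rightarrow> ereal) \<Rightarrow> ennreal" where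
  "C_norm \<rho> M f =
     (SUP A \<in> {A \<in> sets M. measure M A \<noteq> 0}.
        1 / ennreal (\<rho> (measure M A)) * (\<integral>\<^sup>+x\<in>A. e2ennreal \<bar>f x\<bar> \<partial>M))"

definition C_space :: "(real \<Rightarrow> real) \<Rightarrow> 'a measure \<Rightarrow> ('a \<Rightarrow> ereal) set" where
  "C_space \<rho> M = {f \<in> L1_space M. C_norm \<rho> M f < \<infinity>}"

end

theory Submission
  imports Defs
begin

text \<open>
  The integral commutes with ultralimits under uniform integrability, and a uniform bound on the
  norms of the \<open>f\<^sub>i\<close> in the space given by \<open>\<rho>\<close> is a form of uniform integrability.

  The measure. Limits along an ultrafilter always exist in a compact linear order, they are
  additive, and an ultrafilter decides every property; hence the sets \<^term>\<open>ulim_set U I M A\<close> form an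
  algebra on which \<open>A \<mapsto> U-lim \<nu>\<^sub>i(A\<^sub>i)\<close> is a well defined finitely additive set function. It is
  continuous at the empty set for the following reason. Let \<open>C\<^sub>0 \<supseteq> C\<^sub>1 \<supseteq> \<dots>\<close> be families such that the
  limit of \<open>\<nu>\<^sub>i(C\<^sub>n\<^sub>,\<^sub>i)\<close> exceeds \<open>\<epsilon> > 0\<close> for every \<open>n\<close>. For each \<open>i\<close> the set of those \<open>n\<close> with
  \<open>\<nu>\<^sub>i(C\<^sub>n\<^sub>,\<^sub>i) > \<epsilon>\<close> is an initial segment of the natural numbers, and some point \<open>x\<^sub>i\<close> lies in
  \<open>C\<^sub>n\<^sub>,\<^sub>i\<close> for all \<open>n\<close> in it: if the segment is finite, look at its last element (any point
  will do if it is empty); if not, the intersection of all \<open>C\<^sub>n\<^sub>,\<^sub>i\<close> has measure at least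
  \<open>\<epsilon>\<close>. The class of \<open>(x\<^sub>i)\<close> then lies in all the limit sets (\<open>ulim_premeasure_continuous\<close>), and Caratheodory's theorem applies.

  The integral. For bounded nonnegative \<open>h\<^sub>i\<close>, the staircase that counts the integers
  \<open>1 \<le> k \<le> h\<^sub>i\<close> is a finite sum of indicators, for which the claim holds by construction of the
  measure; it is within 1 of \<open>h\<^sub>i\<close>, and so is its limit from the limit of the \<open>h\<^sub>i\<close>. Rescaling \<open>h\<^sub>i\<close> by
  large integers removes the error. Truncation extends this to all nonnegative \<open>h\<^sub>i\<close> whose tails
  \<open>\<integral> (h\<^sub>i - K)\<^sup>+ d\<nu>\<^sub>i\<close> tend to 0 as \<open>K \<rightarrow> \<infinity>\<close>, uniformly in \<open>i\<close>
  (\<open>nn_integral_ulim\<close>). The hypothesis on the norms gives such tails (\<open>C_norm_tail\<close>): by Markov's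
  inequality the set where \<open>\<bar>f\<^sub>i\<bar> \<ge> K\<close> has measure at most \<open>C / K\<close>, so, unless it is null, the
  integral over it is at most \<open>C \<rho>(t)\<close> with \<open>0 < t \<le> C / K\<close>, and \<open>\<rho>(0\<^sup>+) = 0\<close>. The theorem follows by applying this to
  \<open>\<bar>f\<^sub>i\<bar>\<close> and to the positive and negative parts of \<open>f\<^sub>i\<close>.
\<close>

section \<open>Limits along ultrafilters\<close>

lemma ultrafilter_tendsto_Lim:
  fixes f :: "'i \<Rightarrow> 'b::{complete_linorder, linorder_topology}"
  assumes "ultrafilter_on I U"
  shows "(f \<longlongrightarrow> Lim U f) U"
proof -
  have nt: "U \<noteq> bot" and dec: "\<And>P. eventually P U \<or> eventually (\<lambda>i. \<not> P i) U"
    using assms by (auto simp: ultrafilter_on_def)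
  have "Limsup U f \<le> Liminf U f"
    unfolding le_Liminf_iff
  proof (intro allI impI)
    fix y assume y: "y < Limsup U f"
    show "eventually (\<lambda>i. y < f i) U"
    proof (rule ccontr)
      assume "\<not> eventually (\<lambda>i. y < f i) U"
      then have "eventually (\<lambda>i. f i \<le> y) U"
        using dec[of "\<lambda>i. y < f i"] by (simp add: not_less)
      then have "Limsup U f \<le> y" by (rule Limsup_bounded)
      with y show False by simp
    qed
  qed
  then have "Limsup U f = Liminf U f"
    using Liminf_le_Limsup[OF nt] by (rule antisym)
  then have "(f \<longlongrightarrow> Liminf U f) U"
    by (rule tendsto_Liminf[OF nt])
  then show ?thesis
    using tendsto_Lim[OF nt] by fastforce
qed

section \<open>The ultralimit of a family of probability spaces\<close>

text \<open>The standing assumptions on the index filter and the factors of the ultraproduct.\<close>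

locale prob_ultraproduct =
  fixes U :: "'i filter" and I :: "'i set" and M :: "'i \<Rightarrow> 'a measure"
  assumes ultra: "ultrafilter_on I U"
    and prob: "\<And>i. i \<in> I \<Longrightarrow> prob_space (M i)"
begin

abbreviation points :: "('i \<Rightarrow> 'a) set" where
  "points \<equiv> (\<Pi>\<^sub>E i\<in>I. space (M i))"

text \<open>The class of a point of the product in the ultraproduct.\<close>

abbreviation cls :: "('i \<Rightarrow> 'a) \<Rightarrow> ('i \<Rightarrow> 'a) set" where
  "cls x \<equiv> ulim_rel U I M `` {x}"

abbreviation "us \<equiv> ulim_set U I M"

text \<open>
  Families of measurable sets; their values outside \<open>I\<close> are irrelevant for the limit set and are
  left arbitrary, unlike in \<^const>\<open>PiE\<close>, so that pointwise set operations can be applied to them.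
\<close>

abbreviation families :: "('i \<Rightarrow> 'a set) set" where
  "families \<equiv> (\<Pi> i\<in>I. sets (M i))"

lemma not_bot: "U \<noteq> bot"
  and ev_I: "eventually (\<lambda>i. i \<in> I) U"
  using ultra by (auto simp: ultrafilter_on_def)

lemma ev_not_iff: "eventually (\<lambda>i. \<not> P i) U \<longleftrightarrow> \<not> eventually P U"
proof
  assume "eventually (\<lambda>i. \<not> P i) U"
  show "\<not> eventually P U"
  proof
    assume "eventually P U"
    with \<open>eventually (\<lambda>i. \<not> P i) U\<close> have "eventually (\<lambda>i. False) U"
      by eventually_elim auto
    then show False using not_bot by (simp add: trivial_limit_def)
  qed
qed (use ultra in \<open>auto simp: ultrafilter_on_def\<close>)

lemma ev_disj_iff: "eventually (\<lambda>i. P i \<or> Q i) U \<longleftrightarrow> eventually P U \<or> eventually Q U"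
  using ev_not_iff[of "\<lambda>i. \<not> P i \<and> \<not> Q i"] by (simp add: eventually_conj_iff ev_not_iff)

lemma ev_cong_I: "(\<And>i. i \<in> I \<Longrightarrow> P i \<longleftrightarrow> Q i) \<Longrightarrow> eventually P U \<longleftrightarrow> eventually Q U"
  by (rule eventually_cong[OF ev_I]) auto

lemma tendsto_Lim_U:
  fixes f :: "'i \<Rightarrow> 'b::{complete_linorder, linorder_topology}"
  shows "(f \<longlongrightarrow> Lim U f) U"
  by (rule ultrafilter_tendsto_Lim[OF ultra])

lemma Lim_eqI:
  fixes f :: "'i \<Rightarrow> 'b::t2_space"
  shows "(f \<longlongrightarrow> l) U \<Longrightarrow> Lim U f = l"
  by (rule tendsto_Lim[OF not_bot])

lemma equiv_ulim_rel: "equiv points (ulim_rel U I M)"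
proof (rule equivI)
  show "trans (ulim_rel U I M)"
    by (rule transI) (auto simp: ulim_rel_def elim: eventually_elim2)
qed (auto simp: ulim_rel_def refl_on_def sym_def eq_commute)

lemma cls_eq_iff:
  "x \<in> points \<Longrightarrow> y \<in> points \<Longrightarrow> cls x = cls y \<longleftrightarrow> eventually (\<lambda>i. x i = y i) U"
  by (subst eq_equiv_class_iff[OF equiv_ulim_rel]) (auto simp: ulim_rel_def)

lemma ulim_space_eq: "ulim_space U I M = cls ` points"
  by (auto simp: ulim_space_def quotient_def)

lemma cls_in_us_iff:
  assumes x: "x \<in> points"
  shows "cls x \<in> us A \<longleftrightarrow> eventually (\<lambda>i. x i \<in> A i) U"
proof
  assume "cls x \<in> us A"
  then obtain y where y: "y \<in> points" "eventually (\<lambda>i. y i \<in> A i) U" and "cls x = cls y"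
    unfolding ulim_set_def by blast
  then have "eventually (\<lambda>i. x i = y i) U" using x by (simp add: cls_eq_iff)
  with y(2) show "eventually (\<lambda>i. x i \<in> A i) U" by eventually_elim simp
qed (use x in \<open>auto simp: ulim_set_def\<close>)

lemma us_subset: "us A \<subseteq> ulim_space U I M"
  by (auto simp: ulim_set_def ulim_space_eq)

lemma us_image_subset: "us ` F \<subseteq> Pow (ulim_space U I M)"
  by (auto dest: us_subset[THEN subsetD])

lemma us_eqI:
  assumes "S \<subseteq> ulim_space U I M"
    and "\<And>x. x \<in> points \<Longrightarrow> cls x \<in> S \<longleftrightarrow> eventually (\<lambda>i. x i \<in> A i) U"
  shows "us A = S"
  using us_subset[of A] assms by (auto simp: ulim_space_eq cls_in_us_iff)

lemma us_Un: "us (\<lambda>i. A i \<union> B i) = us A \<union> us B"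
  by (rule us_eqI) (use us_subset[of A] us_subset[of B] in
      \<open>auto simp: cls_in_us_iff ev_disj_iff\<close>)

lemma us_Int: "us (\<lambda>i. A i \<inter> B i) = us A \<inter> us B"
  by (rule us_eqI) (use us_subset[of A] us_subset[of B] in
      \<open>auto simp: cls_in_us_iff eventually_conj_iff\<close>)

lemma us_Diff: "us (\<lambda>i. A i - B i) = us A - us B"
  by (rule us_eqI) (use us_subset[of A] us_subset[of B] in
      \<open>auto simp: cls_in_us_iff eventually_conj_iff ev_not_iff\<close>)

lemma us_empty: "us (\<lambda>i. {}) = {}"
  using not_bot by (auto simp: ulim_set_def trivial_limit_def)

lemma us_restrict: "us (restrict A I) = us A"
proof (rule us_eqI[OF us_subset])
  fix x assume "x \<in> points"
  then show "cls x \<in> us A \<longleftrightarrow> eventually (\<lambda>i. x i \<in> restrict A I i) U"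
    unfolding cls_in_us_iff[OF \<open>x \<in> points\<close>] by (intro ev_cong_I) simp
qed

lemma us_image_PiE: "us ` (\<Pi>\<^sub>E i\<in>I. sets (M i)) = us ` families"
proof (intro equalityI subsetI)
  fix S assume "S \<in> us ` families"
  then obtain A where A: "A \<in> families" "S = us A" by auto
  then have "restrict A I \<in> (\<Pi>\<^sub>E i\<in>I. sets (M i))" by auto
  with A show "S \<in> us ` (\<Pi>\<^sub>E i\<in>I. sets (M i))" by (metis us_restrict imageI)
qed (auto simp: PiE_def)

lemma ring_of_us: "ring_of_sets (ulim_space U I M) (us ` families)"
  unfolding ring_of_sets_iff
proof (intro conjI ballI)
  show "{} \<in> us ` families"
    using us_empty by (intro image_eqI[where x = "\<lambda>i. {}"]) auto
next
  fix a b assume "a \<in> us ` families" "b \<in> us ` families"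
  then obtain A B where *: "A \<in> families" "B \<in> families" "a = us A" "b = us B" by auto
  show "a \<union> b \<in> us ` families"
    by (rule image_eqI[where x = "\<lambda>i. A i \<union> B i"]) (use * in \<open>auto simp: us_Un\<close>)
  show "a - b \<in> us ` families"
    by (rule image_eqI[where x = "\<lambda>i. A i - B i"]) (use * in \<open>auto simp: us_Diff\<close>)
qed (rule us_image_subset)

text \<open>
  A limit set determines the family of sets up to \<open>U\<close>-almost all indices: otherwise one could
  choose points in the differences \<open>A i - B i\<close>.
\<close>

lemma us_mono_imp:
  assumes A: "A \<in> families" and sub: "us A \<subseteq> us B"
  shows "eventually (\<lambda>i. A i \<subseteq> B i) U"
proof (rule ccontr)
  assume "\<not> eventually (\<lambda>i. A i \<subseteq> B i) U"
  then have ne: "eventually (\<lambda>i. \<not> A i \<subseteq> B i) U" by (simp add: ev_not_iff)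
  have "\<forall>i\<in>I. \<exists>x\<in>space (M i). \<not> A i \<subseteq> B i \<longrightarrow> x \<in> A i - B i"
  proof
    fix i assume i: "i \<in> I"
    show "\<exists>x\<in>space (M i). \<not> A i \<subseteq> B i \<longrightarrow> x \<in> A i - B i"
      using prob_space.not_empty[OF prob[OF i]] sets.sets_into_space[of "A i" "M i"] A i
      by (cases "A i \<subseteq> B i") auto
  qed
  then obtain y where y: "\<And>i. i \<in> I \<Longrightarrow> y i \<in> space (M i)"
    "\<And>i. i \<in> I \<Longrightarrow> \<not> A i \<subseteq> B i \<Longrightarrow> y i \<in> A i - B i" by metis
  define x where "x = restrict y I"
  have x: "x \<in> points" using y by (auto simp: x_def)
  have ev: "eventually (\<lambda>i. x i \<in> A i - B i) U"
    using ne ev_I by eventually_elim (use y in \<open>auto simp: x_def\<close>)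
  then have "cls x \<in> us A" using x by (auto simp: cls_in_us_iff elim: eventually_mono)
  then have "cls x \<in> us B" using sub by auto
  then have "eventually (\<lambda>i. x i \<in> B i) U" using x by (simp add: cls_in_us_iff)
  with ev have "eventually (\<lambda>i. False) U" by eventually_elim auto
  then show False using not_bot by (simp add: trivial_limit_def)
qed

lemma Lim_emeasure_mono:
  assumes A: "A \<in> families" and B: "B \<in> families" and sub: "us A \<subseteq> us B"
  shows "Lim U (\<lambda>i. emeasure (M i) (A i)) \<le> Lim U (\<lambda>i. emeasure (M i) (B i))"
proof (rule tendsto_le[OF not_bot tendsto_Lim_U tendsto_Lim_U])
  show "eventually (\<lambda>i. emeasure (M i) (A i) \<le> emeasure (M i) (B i)) U"
    using us_mono_imp[OF A sub] ev_I
    by eventually_elim (use B in \<open>auto intro: emeasure_mono\<close>)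
qed

text \<open>
  The set function on limit sets whose extension is the ultralimit measure, defined through an
  arbitrary representing family; by monotonicity the value does not depend on it.
\<close>

definition ulim_premeasure :: "('i \<Rightarrow> 'a) set set \<Rightarrow> ennreal" where
  "ulim_premeasure S =
     Lim U (\<lambda>i. emeasure (M i) ((SOME A. A \<in> families \<and> S = us A) i))"

lemma ulim_premeasure_us:
  assumes "A \<in> families"
  shows "ulim_premeasure (us A) = Lim U (\<lambda>i. emeasure (M i) (A i))"
proof -
  define B where "B = (SOME B. B \<in> families \<and> us A = us B)"
  have "B \<in> families \<and> us A = us B"
    unfolding B_def by (rule someI[where x = A]) (use assms in auto)
  then show ?thesis
    using Lim_emeasure_mono[OF assms, of B] Lim_emeasure_mono[of B A] assms
    unfolding ulim_premeasure_def B_def[symmetric] by (auto intro: antisym)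
qed

lemma ulim_premeasure_mono:
  assumes "S \<in> us ` families" "T \<in> us ` families" "S \<subseteq> T"
  shows "ulim_premeasure S \<le> ulim_premeasure T"
  using assms by (auto simp: ulim_premeasure_us intro: Lim_emeasure_mono)

lemma ulim_premeasure_additive: "additive (us ` families) ulim_premeasure"
  unfolding additive_def
proof (intro ballI impI)
  fix S T assume S: "S \<in> us ` families" and T: "T \<in> us ` families" and disj: "S \<inter> T = {}"
  obtain A B where AB: "A \<in> families" "B \<in> families" "S = us A" "T = us B" using S T by auto
  have AuB: "(\<lambda>i. A i \<union> B i) \<in> families" using AB by auto
  have "eventually (\<lambda>i. A i \<inter> B i \<subseteq> {}) U"
    by (rule us_mono_imp) (use AB disj in \<open>auto simp: us_Int us_empty\<close>)
  then have eq: "eventually (\<lambda>i. emeasure (M i) (A i) + emeasure (M i) (B i) =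
      emeasure (M i) (A i \<union> B i)) U"
    using ev_I by eventually_elim (use AB in \<open>auto intro!: plus_emeasure\<close>)
  have "((\<lambda>i. emeasure (M i) (A i) + emeasure (M i) (B i)) \<longlongrightarrow>
      ulim_premeasure S + ulim_premeasure T) U"
    unfolding AB using AB by (auto simp: ulim_premeasure_us intro!: tendsto_add tendsto_Lim_U)
  then have "((\<lambda>i. emeasure (M i) (A i \<union> B i)) \<longlongrightarrow> ulim_premeasure S + ulim_premeasure T) U"
    using eq by (rule Lim_transform_eventually)
  then show "ulim_premeasure (S \<union> T) = ulim_premeasure S + ulim_premeasure T"
    unfolding AB(3,4) us_Un[symmetric] ulim_premeasure_us[OF AuB] by (rule Lim_eqI)
qed

lemma ulim_premeasure_continuous:
  assumes A: "range A \<subseteq> us ` families" and dec: "decseq A" and empty: "(\<Inter>n. A n) = {}"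
  shows "(\<lambda>n. ulim_premeasure (A n)) \<longlonglongrightarrow> 0"
proof -
  have "decseq (\<lambda>n. ulim_premeasure (A n))"
    unfolding decseq_def using A dec
    by (auto intro!: ulim_premeasure_mono dest: decseqD)
  then have lim: "(\<lambda>n. ulim_premeasure (A n)) \<longlonglongrightarrow> (INF n. ulim_premeasure (A n))"
    by (rule LIMSEQ_INF)
  have "(INF n. ulim_premeasure (A n)) = 0"
  proof (rule ccontr)
    assume "(INF n. ulim_premeasure (A n)) \<noteq> 0"
    then have "0 < (INF n. ulim_premeasure (A n))" by (simp add: zero_less_iff_neq_zero)
    then obtain e where e: "0 < e" "e < (INF n. ulim_premeasure (A n))"
      using dense by blast
    have less: "e < ulim_premeasure (A n)" for n
      using e(2) INF_lower[of n UNIV "\<lambda>n. ulim_premeasure (A n)"] by (simp add: less_le_trans)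
    have "\<forall>n. \<exists>B. B \<in> families \<and> A n = us B" using A by blast
    from choice[OF this] obtain B where B: "\<And>n. B n \<in> families" "\<And>n. A n = us (B n)"
      by blast
    \<comment> \<open>The families \<open>B n\<close> decrease only for almost all \<open>i\<close>, with an exceptional set depending on
      \<open>n\<close>; their finite intersections decrease for all \<open>i\<close>.\<close>
    define C where "C n i = (\<Inter>k\<in>{..n}. B k i)" for n i
    have C: "C n \<in> families" for n
      using B(1) by (fastforce simp: C_def Pi_iff intro!: sets.finite_INT)
    have C_dec: "m \<le> n \<Longrightarrow> C n i \<subseteq> C m i" for m n i
      by (auto simp: C_def)
    have usC: "us (C n) = A n" for n
    proof (rule us_eqI)
      fix x assume x: "x \<in> points"
      have "eventually (\<lambda>i. x i \<in> C n i) U \<longleftrightarrow> (\<forall>k\<in>{..n}. cls x \<in> A k)"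
        by (simp add: C_def eventually_ball_finite_distrib B cls_in_us_iff[OF x])
      also have "\<dots> \<longleftrightarrow> cls x \<in> A n"
        using dec by (auto dest: decseqD)
      finally show "cls x \<in> A n \<longleftrightarrow> eventually (\<lambda>i. x i \<in> C n i) U" by simp
    qed (simp add: B us_subset)
    define J where "J n = {i\<in>I. e < emeasure (M i) (C n i)}" for n
    have J: "eventually (\<lambda>i. i \<in> J n) U" for n
    proof -
      have "e < Lim U (\<lambda>i. emeasure (M i) (C n i))"
        using less[of n] C by (simp flip: usC add: ulim_premeasure_us)
      then have "eventually (\<lambda>i. e < emeasure (M i) (C n i)) U"
        using tendsto_Lim_U by (rule order_tendstoD(1)[rotated])
      then show ?thesis using ev_I by eventually_elim (simp add: J_def)
    qed
    have "\<forall>i\<in>I. \<exists>x\<in>space (M i). \<forall>n. i \<in> J n \<longrightarrow> x \<in> C n i"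
    proof
      fix i assume i: "i \<in> I"
      interpret prob_space "M i" by (rule prob[OF i])
      have Ci: "C n i \<in> events" for n using C[of n] i by auto
      show "\<exists>x\<in>space (M i). \<forall>n. i \<in> J n \<longrightarrow> x \<in> C n i"
      proof (cases "\<forall>n. i \<in> J n")
        case True
        have "(INF n. emeasure (M i) (C n i)) = emeasure (M i) (\<Inter>n. C n i)"
          by (rule INF_emeasure_decseq) (use Ci C_dec in \<open>auto simp: decseq_def\<close>)
        moreover have "e \<le> (INF n. emeasure (M i) (C n i))"
          by (rule INF_greatest) (use True in \<open>auto simp: J_def intro: less_imp_le\<close>)
        ultimately have "(\<Inter>n. C n i) \<noteq> {}" using e(1) by auto
        then obtain x where x: "\<And>n. x \<in> C n i" by auto
        then have "x \<in> space (M i)" using sets.sets_into_space[OF Ci[of 0]] by auto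
        with x show ?thesis by auto
      next
        case False
        define N where "N = (LEAST n. i \<notin> J n)"
        have N: "i \<notin> J N" unfolding N_def using False by (metis LeastI_ex)
        have below: "n < N" if "i \<in> J n" for n
        proof (rule ccontr)
          assume "\<not> n < N"
          then have "emeasure (M i) (C n i) \<le> emeasure (M i) (C N i)"
            using Ci C_dec by (intro emeasure_mono) auto
          with that N i show False by (auto simp: J_def)
        qed
        show ?thesis
        proof (cases N)
          case 0
          then show ?thesis using below not_empty by auto
        next
          case (Suc m)
          then have "i \<in> J m" using not_less_Least[of m "\<lambda>n. i \<notin> J n"] by (simp add: N_def)
          then have "C m i \<noteq> {}" by (auto simp: J_def)
          then obtain x where x: "x \<in> C m i" by auto
          then have "x \<in> space (M i)" using sets.sets_into_space[OF Ci[of m]] by auto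
          moreover have "x \<in> C n i" if "i \<in> J n" for n
            using below[OF that] Suc C_dec[of n m i] x by auto
          ultimately show ?thesis by auto
        qed
      qed
    qed
    then obtain y where y: "\<And>i. i \<in> I \<Longrightarrow> y i \<in> space (M i)"
      "\<And>i n. i \<in> I \<Longrightarrow> i \<in> J n \<Longrightarrow> y i \<in> C n i" by metis
    define x where "x = restrict y I"
    have x: "x \<in> points" using y by (auto simp: x_def)
    have "cls x \<in> A n" for n
      unfolding usC[symmetric] cls_in_us_iff[OF x]
      using J[of n] ev_I by eventually_elim (use y in \<open>auto simp: x_def\<close>)
    then show False using empty by auto
  qed
  with lim show ?thesis by simp
qed

lemma space_ulim_measure: "space (ulim_measure U I M) = cls ` points"
  unfolding ulim_measure_def
  by (subst space_extend_measure) (simp_all only: us_image_subset ulim_space_eq[symmetric])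

lemma us_in_sets:
  assumes "A \<in> families"
  shows "us A \<in> sets (ulim_measure U I M)"
  unfolding ulim_measure_def
  by (subst sets_extend_measure)
    (use assms in \<open>auto simp: us_image_PiE us_image_subset intro!: sigma_sets.Basic\<close>)

lemma emeasure_us_PiE:
  assumes A: "A \<in> (\<Pi>\<^sub>E i\<in>I. sets (M i))"
  shows "emeasure (ulim_measure U I M) (us A) = Lim U (\<lambda>i. emeasure (M i) (A i))"
proof -
  interpret ring_of_sets "ulim_space U I M" "us ` families" by (rule ring_of_us)
  have "\<exists>\<mu>. (\<forall>S\<in>us ` families. \<mu> S = ulim_premeasure S) \<and>
      measure_space (ulim_space U I M) (sigma_sets (ulim_space U I M) (us ` families)) \<mu>"
  proof (rule caratheodory_empty_continuous[OF _ ulim_premeasure_additive])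
    have "Lim U (\<lambda>i. emeasure (M i) {}) = 0" by (rule Lim_eqI) simp
    then show "positive (us ` families) ulim_premeasure"
      using ulim_premeasure_us[of "\<lambda>i. {}"] by (simp add: positive_def us_empty)
    fix S assume "S \<in> us ` families"
    then obtain A where A: "A \<in> families" "S = us A" by auto
    have "Lim U (\<lambda>i. emeasure (M i) (A i)) \<le> 1"
      by (rule tendsto_upperbound[OF tendsto_Lim_U eventually_mono[OF ev_I] not_bot])
        (simp add: prob_space.emeasure_le_1 prob)
    then show "ulim_premeasure S \<noteq> \<infinity>" using A by (auto simp: ulim_premeasure_us top_unique)
  qed (rule ulim_premeasure_continuous)
  then obtain \<mu> where \<mu>: "\<And>S. S \<in> us ` families \<Longrightarrow> \<mu> S = ulim_premeasure S"
      "measure_space (ulim_space U I M) (sigma_sets (ulim_space U I M) (us ` families)) \<mu>"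
    by blast
  have sets: "sets (ulim_measure U I M) = sigma_sets (ulim_space U I M) (us ` families)"
    unfolding ulim_measure_def us_image_PiE[symmetric]
    by (subst sets_extend_measure) (simp_all add: us_image_subset)
  show ?thesis
  proof (rule emeasure_extend_measure[OF ulim_measure_def])
    fix B assume "B \<in> (\<Pi>\<^sub>E i\<in>I. sets (M i))"
    then have "B \<in> families" by (auto simp: PiE_def)
    then show "\<mu> (us B) = Lim U (\<lambda>i. emeasure (M i) (B i))"
      by (simp add: \<mu>(1) ulim_premeasure_us)
  qed (use us_image_subset \<mu>(2) A in \<open>auto simp: sets measure_space_def\<close>)
qed

lemma emeasure_us:
  assumes "A \<in> families"
  shows "emeasure (ulim_measure U I M) (us A) = Lim U (\<lambda>i. emeasure (M i) (A i))"
proof -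
  have "emeasure (ulim_measure U I M) (us (restrict A I)) =
      Lim U (\<lambda>i. emeasure (M i) (restrict A I i))"
    by (rule emeasure_us_PiE) (use assms in auto)
  also have "\<dots> = Lim U (\<lambda>i. emeasure (M i) (A i))"
    by (rule Lim_cong[OF eventually_mono[OF ev_I]]) auto
  finally show ?thesis by (simp add: us_restrict)
qed

lemma emeasure_us_tendsto:
  assumes "A \<in> families"
  shows "((\<lambda>i. emeasure (M i) (A i)) \<longlongrightarrow> emeasure (ulim_measure U I M) (us A)) U"
  unfolding emeasure_us[OF assms] by (rule tendsto_Lim_U)

lemma emeasure_ulim_space: "emeasure (ulim_measure U I M) (space (ulim_measure U I M)) = 1"
proof -
  have eq: "us (\<lambda>i. space (M i)) = space (ulim_measure U I M)"
    unfolding space_ulim_measure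
    by (rule us_eqI) (auto simp: ulim_space_eq intro!: eventually_mono[OF ev_I])
  have "Lim U (\<lambda>i. emeasure (M i) (space (M i))) = 1"
    by (rule Lim_eqI, rule tendsto_eventually, rule eventually_mono[OF ev_I])
      (simp add: prob prob_space.emeasure_space_1)
  then show ?thesis
    using emeasure_us[of "\<lambda>i. space (M i)"] by (simp add: eq)
qed

lemma prob_space_ulim: "prob_space (ulim_measure U I M)"
  by (rule prob_spaceI) (rule emeasure_ulim_space)

section \<open>Ultralimits of measurable functions\<close>

lemma ulim_fun_cls:
  assumes x: "x \<in> points"
  shows "ulim_fun U f (cls x) = Lim U (\<lambda>i. f i (x i))"
proof -
  have "(\<lambda>y. Lim U (\<lambda>i. f i (y i))) ` cls x = {Lim U (\<lambda>i. f i (x i))}"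
  proof (intro equalityI subsetI)
    fix l assume "l \<in> (\<lambda>y. Lim U (\<lambda>i. f i (y i))) ` cls x"
    then obtain y where y: "eventually (\<lambda>i. x i = y i) U" "l = Lim U (\<lambda>i. f i (y i))"
      by (auto simp: ulim_rel_def)
    have "Lim U (\<lambda>i. f i (y i)) = Lim U (\<lambda>i. f i (x i))"
      by (rule Lim_cong[OF _ refl]) (use y(1) in \<open>auto elim: eventually_mono\<close>)
    with y show "l \<in> {Lim U (\<lambda>i. f i (x i))}" by simp
  next
    fix l assume "l \<in> {Lim U (\<lambda>i. f i (x i))}"
    then show "l \<in> (\<lambda>y. Lim U (\<lambda>i. f i (y i))) ` cls x"
      using x by (auto simp: ulim_rel_def intro!: image_eqI[where x = x])
  qed
  then show ?thesis by (simp add: ulim_fun_def)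
qed

lemma ulim_fun_tendsto:
  assumes "x \<in> points"
  shows "((\<lambda>i. f i (x i)) \<longlongrightarrow> ulim_fun U f (cls x)) U"
  unfolding ulim_fun_cls[OF assms] by (rule tendsto_Lim_U)

text \<open>
  The limit sets of \<open>{f\<^sub>i > q}\<close> and \<open>{lim f\<^sub>i > q}\<close> differ in general, because strict inequalities
  need not pass to the limit, but the union of the former over all rational \<open>q > y\<close> is \<open>{lim f\<^sub>i > y}\<close>.
\<close>

lemma ulim_fun_measurable:
  assumes f: "\<And>i. i \<in> I \<Longrightarrow> f i \<in> borel_measurable (M i)"
  shows "ulim_fun U f \<in> borel_measurable (ulim_measure U I M)"
proof (rule borel_measurableI_greater)
  fix y :: ereal
  define A where "A q i = {x\<in>space (M i). ereal (of_rat q) < f i x}" for q i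
  have A: "A q \<in> families" for q using f by (auto simp: A_def)
  have "{c \<in> space (ulim_measure U I M). y < ulim_fun U f c} =
      (\<Union>q\<in>{q. y < ereal (of_rat q)}. us (A q))" (is "?L = ?R")
  proof (intro equalityI subsetI)
    fix c assume "c \<in> ?L"
    then obtain x where x: "x \<in> points" "c = cls x" and "y < ulim_fun U f (cls x)"
      by (auto simp: space_ulim_measure)
    then obtain q where q: "y < ereal (of_rat q)" "ereal (of_rat q) < ulim_fun U f (cls x)"
      using ereal_dense3 by blast
    have "eventually (\<lambda>i. ereal (of_rat q) < f i (x i)) U"
      using ulim_fun_tendsto[OF x(1)] q(2) by (rule order_tendstoD)
    then have "eventually (\<lambda>i. x i \<in> A q i) U"
      using ev_I by eventually_elim (use x in \<open>auto simp: A_def PiE_iff\<close>)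
    then show "c \<in> ?R" using q x by (auto simp: cls_in_us_iff)
  next
    fix c assume "c \<in> ?R"
    then obtain q where q: "y < ereal (of_rat q)" "c \<in> us (A q)" by auto
    then obtain x where x: "x \<in> points" "c = cls x" using us_subset by (auto simp: ulim_space_eq)
    have "eventually (\<lambda>i. x i \<in> A q i) U" using q x by (simp add: cls_in_us_iff)
    then have "ereal (of_rat q) \<le> ulim_fun U f (cls x)"
      by (intro tendsto_lowerbound[OF ulim_fun_tendsto[OF x(1)] _ not_bot])
        (auto simp: A_def elim: eventually_mono)
    then show "c \<in> ?L" using q x by (auto simp: space_ulim_measure)
  qed
  also have "\<dots> \<in> sets (ulim_measure U I M)"
    using us_in_sets[OF A] by (intro sets.countable_UN') auto
  finally show "{c \<in> space (ulim_measure U I M). y < ulim_fun U f c} \<in> sets (ulim_measure U I M)" .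
qed

lemma indicator_us_tendsto:
  assumes x: "x \<in> points"
  shows "((\<lambda>i. indicator (A i) (x i) :: ennreal) \<longlongrightarrow> indicator (us A) (cls x)) U"
proof (rule tendsto_eventually, cases "cls x \<in> us A")
  case True
  then show "eventually (\<lambda>i. indicator (A i) (x i) = (indicator (us A) (cls x) :: ennreal)) U"
    using x by (auto simp: cls_in_us_iff elim: eventually_mono)
next
  case False
  then have "eventually (\<lambda>i. x i \<notin> A i) U" using x by (simp add: cls_in_us_iff ev_not_iff)
  with False show "eventually (\<lambda>i. indicator (A i) (x i) = (indicator (us A) (cls x) :: ennreal)) U"
    by (auto elim: eventually_mono)
qed

end

section \<open>Integrals of nonnegative functions\<close>

text \<open>
  The staircase approximation with integer steps. The error 1 is absolute, so that it can be removed
  afterwards by rescaling.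
\<close>

lemma staircase_approx:
  fixes t :: ennreal
  assumes "t \<le> of_nat N"
  defines "s \<equiv> (\<Sum>k=1..N. indicator {x. of_nat k \<le> x} t)"
  shows "s \<le> t" and "t \<le> s + 1"
proof -
  obtain r where r: "0 \<le> r" "t = ennreal r"
    using assms(1) by (cases t) (auto simp: top_unique)
  have le_iff: "of_nat k \<le> t \<longleftrightarrow> real k \<le> r" for k
    using r by (simp flip: ennreal_of_nat_eq_real_of_nat)
  have "r \<le> real N"
    using assms(1) r by (simp flip: ennreal_of_nat_eq_real_of_nat)
  then have "{k\<in>{1..N}. of_nat k \<le> t} = {1..nat \<lfloor>r\<rfloor>}"
    using r(1) by (auto simp: le_iff le_nat_floor) (linarith)+
  then have "s = of_nat (nat \<lfloor>r\<rfloor>)"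
    unfolding s_def by (simp add: indicator_def sum.If_cases Int_def flip: sum.inter_filter)
  then have s: "s = ennreal (real (nat \<lfloor>r\<rfloor>))"
    by (simp add: ennreal_of_nat_eq_real_of_nat)
  show "s \<le> t" unfolding s r by (rule ennreal_leI) (use r(1) in linarith)
  have "ennreal r \<le> ennreal (real (nat \<lfloor>r\<rfloor>) + 1)"
    by (rule ennreal_leI) (use r(1) in linarith)
  then show "t \<le> s + 1" unfolding s r by simp
qed

context prob_ultraproduct
begin

text \<open>
  In the lemmas below \<open>h i\<close> is a family of functions with pointwise ultralimit \<open>H\<close>.
\<close>

lemma nn_integral_ulim_bounded_approx:
  fixes h :: "'i \<Rightarrow> 'a \<Rightarrow> ennreal" and H :: "('i \<Rightarrow> 'a) set \<Rightarrow> ennreal"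
  assumes h [measurable]: "\<And>i. i \<in> I \<Longrightarrow> h i \<in> borel_measurable (M i)"
    and H: "\<And>x. x \<in> points \<Longrightarrow> ((\<lambda>i. h i (x i)) \<longlongrightarrow> H (cls x)) U"
    and bound: "\<And>i x. i \<in> I \<Longrightarrow> x \<in> space (M i) \<Longrightarrow> h i x \<le> of_nat N"
  defines "L \<equiv> Lim U (\<lambda>i. \<integral>\<^sup>+x. h i x \<partial>M i)"
  shows "(\<integral>\<^sup>+c. H c \<partial>ulim_measure U I M) \<le> L + 1"
    and "L \<le> (\<integral>\<^sup>+c. H c \<partial>ulim_measure U I M) + 1"
proof -
  define \<nu> where "\<nu> = ulim_measure U I M"
  interpret \<nu>: prob_space \<nu> unfolding \<nu>_def by (rule prob_space_ulim)
  define A where "A k i = {x\<in>space (M i). of_nat k \<le> h i x}" for k i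
  have A: "A k \<in> families" for k
    using h by (auto simp: A_def)
  define s where "s i x = (\<Sum>k=1..N. indicator (A k i) x :: ennreal)" for i x
  define S where "S c = (\<Sum>k=1..N. indicator (us (A k)) c :: ennreal)" for c
  have usA [measurable]: "us (A k) \<in> sets \<nu>" for k
    unfolding \<nu>_def by (rule us_in_sets[OF A])
  have s_le: "s i x \<le> h i x" "h i x \<le> s i x + 1" if "i \<in> I" "x \<in> space (M i)" for i x
    using staircase_approx[OF bound[OF that]] that(2) by (simp_all add: s_def A_def indicator_def)
  have S_le: "S c \<le> H c" "H c \<le> S c + 1" if c: "c \<in> space \<nu>" for c
  proof -
    obtain x where x: "x \<in> points" "c = cls x" using c by (auto simp: \<nu>_def space_ulim_measure)
    have lim: "((\<lambda>i. s i (x i)) \<longlongrightarrow> S c) U"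
      unfolding s_def S_def x(2) by (intro tendsto_sum indicator_us_tendsto x(1))
    have limH: "((\<lambda>i. h i (x i)) \<longlongrightarrow> H c) U" using H[OF x(1)] x(2) by simp
    have in_sp: "x i \<in> space (M i)" if "i \<in> I" for i using x(1) that by (auto simp: PiE_iff)
    show "S c \<le> H c"
      by (rule tendsto_le[OF not_bot limH lim], rule eventually_mono[OF ev_I])
        (simp add: s_le in_sp)
    show "H c \<le> S c + 1"
      by (rule tendsto_le[OF not_bot tendsto_add[OF lim tendsto_const] limH],
          rule eventually_mono[OF ev_I]) (simp add: s_le in_sp)
  qed
  have int_s: "(\<integral>\<^sup>+x. s i x \<partial>M i) = (\<Sum>k=1..N. emeasure (M i) (A k i))" if i: "i \<in> I" for i
    unfolding s_def using A i by (subst nn_integral_sum) (auto simp: Pi_iff)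
  have int_S: "(\<integral>\<^sup>+c. S c \<partial>\<nu>) = (\<Sum>k=1..N. emeasure \<nu> (us (A k)))"
    unfolding S_def by (subst nn_integral_sum) auto
  have "((\<lambda>i. \<Sum>k=1..N. emeasure (M i) (A k i)) \<longlongrightarrow> (\<integral>\<^sup>+c. S c \<partial>\<nu>)) U"
    unfolding int_S unfolding \<nu>_def by (intro tendsto_sum emeasure_us_tendsto A)
  then have lim_s: "((\<lambda>i. \<integral>\<^sup>+x. s i x \<partial>M i) \<longlongrightarrow> (\<integral>\<^sup>+c. S c \<partial>\<nu>)) U"
    by (rule Lim_transform_eventually, intro eventually_mono[OF ev_I]) (simp add: int_s)
  have lim_h: "((\<lambda>i. \<integral>\<^sup>+x. h i x \<partial>M i) \<longlongrightarrow> L) U"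
    unfolding L_def by (rule tendsto_Lim_U)
  have S_meas [measurable]: "S \<in> borel_measurable \<nu>"
    unfolding S_def by measurable
  have plus1: "(\<integral>\<^sup>+c. S c + 1 \<partial>\<nu>) = (\<integral>\<^sup>+c. S c \<partial>\<nu>) + 1"
    by (subst nn_integral_add) (auto simp: \<nu>.emeasure_space_1)
  have "(\<integral>\<^sup>+c. H c \<partial>\<nu>) \<le> (\<integral>\<^sup>+c. S c \<partial>\<nu>) + 1"
    unfolding plus1[symmetric] by (rule nn_integral_mono) (simp add: S_le)
  also have "(\<integral>\<^sup>+c. S c \<partial>\<nu>) \<le> L"
    by (rule tendsto_le[OF not_bot lim_h lim_s], rule eventually_mono[OF ev_I])
      (auto intro!: nn_integral_mono s_le)
  finally show "(\<integral>\<^sup>+c. H c \<partial>ulim_measure U I M) \<le> L + 1" by (simp add: \<nu>_def)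
  have "L \<le> (\<integral>\<^sup>+c. S c \<partial>\<nu>) + 1"
  proof (rule tendsto_le[OF not_bot tendsto_add[OF lim_s tendsto_const] lim_h],
      rule eventually_mono[OF ev_I])
    fix i assume i: "i \<in> I"
    interpret prob_space "M i" by (rule prob[OF i])
    have "s i \<in> borel_measurable (M i)" unfolding s_def using A i by (auto simp: Pi_iff)
    then have "(\<integral>\<^sup>+x. s i x + 1 \<partial>M i) = (\<integral>\<^sup>+x. s i x \<partial>M i) + 1"
      by (subst nn_integral_add) (auto simp: emeasure_space_1)
    moreover have "(\<integral>\<^sup>+x. h i x \<partial>M i) \<le> (\<integral>\<^sup>+x. s i x + 1 \<partial>M i)"
      using i by (intro nn_integral_mono s_le) auto
    ultimately show "(\<integral>\<^sup>+x. h i x \<partial>M i) \<le> (\<integral>\<^sup>+x. s i x \<partial>M i) + 1" by simp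
  qed
  also have "(\<integral>\<^sup>+c. S c \<partial>\<nu>) \<le> (\<integral>\<^sup>+c. H c \<partial>\<nu>)"
    by (rule nn_integral_mono) (simp add: S_le)
  finally show "L \<le> (\<integral>\<^sup>+c. H c \<partial>ulim_measure U I M) + 1" by (simp add: \<nu>_def)
qed

lemma nn_integral_ulim_bounded:
  fixes h :: "'i \<Rightarrow> 'a \<Rightarrow> ennreal" and H :: "('i \<Rightarrow> 'a) set \<Rightarrow> ennreal"
  assumes h: "\<And>i. i \<in> I \<Longrightarrow> h i \<in> borel_measurable (M i)"
    and H_meas: "H \<in> borel_measurable (ulim_measure U I M)"
    and H: "\<And>x. x \<in> points \<Longrightarrow> ((\<lambda>i. h i (x i)) \<longlongrightarrow> H (cls x)) U"
    and bound: "\<And>i x. i \<in> I \<Longrightarrow> x \<in> space (M i) \<Longrightarrow> h i x \<le> of_nat N"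
  shows "((\<lambda>i. \<integral>\<^sup>+x. h i x \<partial>M i) \<longlongrightarrow> (\<integral>\<^sup>+c. H c \<partial>ulim_measure U I M)) U"
proof -
  define L where "L = Lim U (\<lambda>i. \<integral>\<^sup>+x. h i x \<partial>M i)"
  define J where "J = (\<integral>\<^sup>+c. H c \<partial>ulim_measure U I M)"
  have lim: "((\<lambda>i. \<integral>\<^sup>+x. h i x \<partial>M i) \<longlongrightarrow> L) U"
    unfolding L_def by (rule tendsto_Lim_U)
  have scaled: "of_nat n * J \<le> of_nat n * L + 1 \<and> of_nat n * L \<le> of_nat n * J + 1" for n
  proof -
    have int: "(\<integral>\<^sup>+x. of_nat n * h i x \<partial>M i) = of_nat n * (\<integral>\<^sup>+x. h i x \<partial>M i)" if "i \<in> I" for i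
      using h[OF that] by (rule nn_integral_cmult)
    have intJ: "(\<integral>\<^sup>+c. of_nat n * H c \<partial>ulim_measure U I M) = of_nat n * J"
      unfolding J_def using H_meas by (rule nn_integral_cmult)
    have "((\<lambda>i. of_nat n * (\<integral>\<^sup>+x. h i x \<partial>M i)) \<longlongrightarrow> of_nat n * L) U"
      using lim by (intro ennreal_tendsto_cmult) (auto simp: less_top[symmetric])
    then have "((\<lambda>i. \<integral>\<^sup>+x. of_nat n * h i x \<partial>M i) \<longlongrightarrow> of_nat n * L) U"
      by (rule Lim_transform_eventually, intro eventually_mono[OF ev_I]) (simp add: int)
    then have limL: "Lim U (\<lambda>i. \<integral>\<^sup>+x. of_nat n * h i x \<partial>M i) = of_nat n * L"
      by (rule Lim_eqI)
    have nh: "\<And>i. i \<in> I \<Longrightarrow> (\<lambda>x. of_nat n * h i x) \<in> borel_measurable (M i)"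
      using h by measurable
    have nH: "((\<lambda>i. of_nat n * h i (x i)) \<longlongrightarrow> of_nat n * H (cls x)) U" if "x \<in> points" for x
      using H[OF that] by (intro ennreal_tendsto_cmult) (auto simp: less_top[symmetric])
    have nb: "of_nat n * h i x \<le> of_nat (n * N)" if "i \<in> I" "x \<in> space (M i)" for i x
      using mult_left_mono[OF bound[OF that], of "of_nat n"] by simp
    show ?thesis
      using nn_integral_ulim_bounded_approx[of "\<lambda>i x. of_nat n * h i x"
          "\<lambda>c. of_nat n * H c" "n * N", OF nh nH nb]
      unfolding limL intJ by simp
  qed
  have cancel: "a \<le> b" if le: "\<And>n. of_nat n * a \<le> of_nat n * b + 1" for a b :: ennreal
  proof (rule ennreal_le_epsilon)
    fix e :: real assume "b < top" "0 < e"
    then obtain n where n: "1 / e < real n" using reals_Archimedean2 by blast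
    with \<open>0 < e\<close> have n0: "0 < real n" by (meson divide_pos_pos less_trans zero_less_one)
    have "1 \<le> real n * e" using n \<open>0 < e\<close> by (simp add: field_simps)
    then have "(1::ennreal) \<le> of_nat n * ennreal e"
      using \<open>0 < e\<close> by (simp add: ennreal_of_nat_eq_real_of_nat flip: ennreal_mult)
    then have "of_nat n * a \<le> of_nat n * (b + ennreal e)"
      using le[of n] by (simp add: distrib_left) (meson add_left_mono order_trans)
    then show "a \<le> b + ennreal e"
      using n0 by (subst (asm) ennreal_mult_le_mult_iff) auto
  qed
  have "J \<le> L" by (rule cancel) (rule scaled[THEN conjunct1])
  moreover have "L \<le> J" by (rule cancel) (rule scaled[THEN conjunct2])
  ultimately have "J = L" by simp
  with lim show ?thesis by (simp add: J_def)
qed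

text \<open>
  The hypothesis on the tails is one form of uniform integrability of the family \<open>h i\<close>. Only the
  inequality \<open>lim \<integral> h i \<le> \<integral> H\<close> depends on it.
\<close>

lemma nn_integral_ulim:
  fixes h :: "'i \<Rightarrow> 'a \<Rightarrow> ennreal" and H :: "('i \<Rightarrow> 'a) set \<Rightarrow> ennreal"
  assumes h: "\<And>i. i \<in> I \<Longrightarrow> h i \<in> borel_measurable (M i)"
    and H_meas: "H \<in> borel_measurable (ulim_measure U I M)"
    and H: "\<And>x. x \<in> points \<Longrightarrow> ((\<lambda>i. h i (x i)) \<longlongrightarrow> H (cls x)) U"
    and tail: "\<And>e::real. 0 < e \<Longrightarrow> \<exists>K::nat. \<forall>i\<in>I. (\<integral>\<^sup>+x. h i x - of_nat K \<partial>M i) \<le> ennreal e"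
  shows "((\<lambda>i. \<integral>\<^sup>+x. h i x \<partial>M i) \<longlongrightarrow> (\<integral>\<^sup>+c. H c \<partial>ulim_measure U I M)) U"
proof -
  define L where "L = Lim U (\<lambda>i. \<integral>\<^sup>+x. h i x \<partial>M i)"
  define J where "J = (\<integral>\<^sup>+c. H c \<partial>ulim_measure U I M)"
  have lim: "((\<lambda>i. \<integral>\<^sup>+x. h i x \<partial>M i) \<longlongrightarrow> L) U"
    unfolding L_def by (rule tendsto_Lim_U)
  define JK where "JK K = (\<integral>\<^sup>+c. min (H c) (of_nat K) \<partial>ulim_measure U I M)" for K :: nat
  have trunc: "((\<lambda>i. \<integral>\<^sup>+x. min (h i x) (of_nat K) \<partial>M i) \<longlongrightarrow> JK K) U" for K
    unfolding JK_def
    by (rule nn_integral_ulim_bounded[where N = K]) (use h H_meas H in \<open>auto intro!: tendsto_min\<close>)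
  have JK_le_L: "JK K \<le> L" for K
    by (rule tendsto_le[OF not_bot lim trunc]) (auto intro!: always_eventually nn_integral_mono)
  have "J = (\<integral>\<^sup>+c. (SUP K. min (H c) (of_nat K)) \<partial>ulim_measure U I M)"
    unfolding J_def
  proof (rule nn_integral_cong)
    fix c
    have "(SUP K. min (H c) (of_nat K)) = inf (H c) (SUP K. of_nat K)"
      by (simp add: inf_SUP flip: inf_min)
    then show "H c = (SUP K. min (H c) (of_nat K))"
      by (simp add: ennreal_SUP_of_nat_eq_top)
  qed
  also have "\<dots> = (SUP K. JK K)"
    unfolding JK_def
    by (rule nn_integral_monotone_convergence_SUP)
      (use H_meas in \<open>auto simp: incseq_def le_fun_def intro: min.coboundedI2\<close>)
  also have "\<dots> \<le> L" by (rule SUP_least) (rule JK_le_L)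
  finally have "J \<le> L" .
  moreover have "L \<le> J"
  proof (rule ennreal_le_epsilon)
    fix e :: real assume "0 < e"
    then obtain K where K: "\<And>i. i \<in> I \<Longrightarrow> (\<integral>\<^sup>+x. h i x - of_nat K \<partial>M i) \<le> ennreal e"
      using tail by meson
    have "(\<integral>\<^sup>+x. h i x \<partial>M i) \<le> (\<integral>\<^sup>+x. min (h i x) (of_nat K) \<partial>M i) + ennreal e" if i: "i \<in> I" for i
    proof -
      have "t = min t (of_nat K) + (t - of_nat K)" for t :: ennreal
      proof (cases "t \<le> of_nat K")
        case True
        then have "t - of_nat K = 0"
          by (intro diff_eq_0_ennreal) (simp_all add: le_less_trans[OF _ of_nat_less_top])
        with True show ?thesis by simp
      qed (simp add: min_def add_diff_inverse_ennreal)
      then have "(\<integral>\<^sup>+x. h i x \<partial>M i) = (\<integral>\<^sup>+x. min (h i x) (of_nat K) + (h i x - of_nat K) \<partial>M i)"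
        by (intro nn_integral_cong) simp
      also have "\<dots> = (\<integral>\<^sup>+x. min (h i x) (of_nat K) \<partial>M i) + (\<integral>\<^sup>+x. h i x - of_nat K \<partial>M i)"
        by (rule nn_integral_add) (use h[OF i] in measurable)
      finally show ?thesis using K[OF i] by (simp add: add_left_mono)
    qed
    then have "L \<le> JK K + ennreal e"
      by (intro tendsto_le[OF not_bot tendsto_add[OF trunc tendsto_const] lim]
          eventually_mono[OF ev_I]) auto
    also have "JK K \<le> J"
      unfolding JK_def J_def by (rule nn_integral_mono) simp
    finally show "L \<le> J + ennreal e" by simp
  qed
  ultimately have "J = L" by (rule antisym)
  with lim show ?thesis by (simp add: J_def)
qed

end

section \<open>Uniform integrability from a majorant\<close>

lemma C_norm_integral_le:
  assumes "A \<in> sets M" "measure M A \<noteq> 0" "C_norm \<rho> M f \<le> ennreal C"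
  shows "(\<integral>\<^sup>+x\<in>A. e2ennreal \<bar>f x\<bar> \<partial>M) \<le> ennreal C * ennreal (\<rho> (measure M A))"
    (is "?a \<le> _ * ?r")
proof -
  have "1 / ?r * ?a \<le> C_norm \<rho> M f"
    unfolding C_norm_def by (rule SUP_upper) (use assms in auto)
  then have le: "1 / ?r * ?a \<le> ennreal C" using assms(3) by simp
  show ?thesis
  proof (cases "?r = 0")
    \<comment> \<open>Here \<open>1 / ?r\<close> is infinite, and the bound forces the integral to vanish.\<close>
    case True
    then have "?a = 0" using le by (auto simp: ennreal_top_mult top_unique split: if_splits)
    then show ?thesis by simp
  next
    case False
    have "?a = ?r * (1 / ?r * ?a)"
      using False by (simp add: ennreal_times_divide ennreal_mult_divide_eq flip: mult.assoc)
    also have "\<dots> \<le> ?r * ennreal C" using le by (rule mult_left_mono) simp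
    finally show ?thesis by (simp add: mult.commute)
  qed
qed

lemma C_norm_nn_integral_le:
  assumes "prob_space M" "\<rho> \<in> majorants" "C_norm \<rho> M f \<le> ennreal C"
  shows "(\<integral>\<^sup>+x. e2ennreal \<bar>f x\<bar> \<partial>M) \<le> ennreal C"
proof -
  interpret prob_space M by fact
  have "(\<integral>\<^sup>+x. e2ennreal \<bar>f x\<bar> \<partial>M) = (\<integral>\<^sup>+x\<in>space M. e2ennreal \<bar>f x\<bar> \<partial>M)"
    by (intro nn_integral_cong) simp
  also have "\<dots> \<le> ennreal C"
    using C_norm_integral_le[of "space M" M \<rho> f C] assms by (simp add: prob_space majorants_def)
  finally show ?thesis .
qed

text \<open>
  The threshold \<open>K\<close> depends on \<open>\<rho>\<close>, the bound on the norm and \<open>e\<close>, but on neither the probability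
  space nor the function.
\<close>

lemma C_norm_tail:
  assumes \<rho>: "\<rho> \<in> majorants" and e: "0 < e" and C: "0 \<le> C"
  shows "\<exists>K::nat. \<forall>M f. prob_space M \<longrightarrow> f \<in> borel_measurable M \<longrightarrow> C_norm \<rho> M f \<le> ennreal C \<longrightarrow>
    (\<integral>\<^sup>+x. e2ennreal \<bar>f x\<bar> - of_nat K \<partial>M) \<le> ennreal e"
proof -
  have "(\<rho> \<longlongrightarrow> 0) (at_right 0)" using \<rho> by (simp add: majorants_def)
  \<comment> \<open>\<open>e / C\<close> would do, except that \<open>C\<close> may be 0.\<close>
  then have "eventually (\<lambda>t. \<rho> t < e / (C + 1)) (at_right 0)"
    using e C by (intro order_tendstoD(2)) auto
  then obtain d where d: "0 < d" "\<And>t. 0 < t \<Longrightarrow> t < d \<Longrightarrow> \<rho> t < e / (C + 1)"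
    unfolding eventually_at_right_field by auto
  obtain K where K: "C / d < real K" using reals_Archimedean2 by blast
  then have "C < real K * d" using d by (simp add: field_simps)
  have K0: "0 < real K" using K C d(1) by (meson divide_nonneg_pos le_less_trans)
  show ?thesis
  proof (intro exI[of _ K] allI impI)
    fix M :: "'b measure" and f :: "'b \<Rightarrow> ereal"
    assume M: "prob_space M" and f [measurable]: "f \<in> borel_measurable M"
      and norm: "C_norm \<rho> M f \<le> ennreal C"
    interpret prob_space M by fact
    define g where "g x = e2ennreal \<bar>f x\<bar>" for x
    have [measurable]: "g \<in> borel_measurable M" unfolding g_def by measurable
    define A where "A = {x\<in>space M. of_nat K \<le> g x}"
    have A [measurable]: "A \<in> sets M" unfolding A_def by measurable
    have "(\<integral>\<^sup>+x. g x - of_nat K \<partial>M) \<le> (\<integral>\<^sup>+x\<in>A. g x \<partial>M)"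
    proof (rule nn_integral_mono)
      fix x assume x: "x \<in> space M"
      show "g x - of_nat K \<le> g x * indicator A x"
      proof (cases "x \<in> A")
        case False
        then have "g x < of_nat K" using x by (simp add: A_def not_le)
        then have "g x - of_nat K = 0"
          by (intro diff_eq_0_ennreal) (auto intro: less_le_trans)
        then show ?thesis by simp
      qed (simp add: diff_le_self_ennreal)
    qed
    also have "\<dots> \<le> ennreal e"
    proof (cases "measure M A = 0")
      case True
      then have "A \<in> null_sets M" using A by (auto simp: emeasure_eq_measure)
      then have "(\<integral>\<^sup>+x\<in>A. g x \<partial>M) = 0" by (rule nn_integral_null_set)
      then show ?thesis by simp
    next
      case False
      have "of_nat K * emeasure M A = (\<integral>\<^sup>+x\<in>A. of_nat K \<partial>M)"
        by (simp add: nn_integral_cmult_indicator)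
      also have "\<dots> \<le> (\<integral>\<^sup>+x. g x \<partial>M)"
        by (rule nn_integral_mono) (auto simp: A_def indicator_def)
      also have "\<dots> \<le> ennreal C"
        unfolding g_def by (rule C_norm_nn_integral_le[OF M \<rho> norm])
      finally have "real K * measure M A \<le> C"
        using C by (simp add: emeasure_eq_measure ennreal_of_nat_eq_real_of_nat flip: ennreal_mult)
      then have "real K * measure M A < real K * d" using \<open>C < real K * d\<close> by simp
      then have small: "measure M A < d" using K0 by simp
      have pos: "0 < measure M A" using False by (simp add: zero_less_measure_iff)
      have "(\<integral>\<^sup>+x\<in>A. g x \<partial>M) \<le> ennreal C * ennreal (\<rho> (measure M A))"
        unfolding g_def by (rule C_norm_integral_le[OF A False norm])
      also have "\<dots> \<le> ennreal C * ennreal (e / (C + 1))"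
        using d(2)[OF pos small] by (intro mult_left_mono ennreal_leI) auto
      also have "\<dots> = ennreal (C * (e / (C + 1)))"
        using C e by (simp flip: ennreal_mult)
      also have "\<dots> \<le> ennreal e"
        using C e by (intro ennreal_leI) (simp add: field_simps)
      finally show ?thesis .
    qed
    finally show "(\<integral>\<^sup>+x. e2ennreal \<bar>f x\<bar> - of_nat K \<partial>M) \<le> ennreal e" by (simp add: g_def)
  qed
qed

section \<open>The integral of an ultralimit\<close>

theorem theorem2p2p3:
  fixes U :: "'i filter" and I :: "'i set"
    and M :: "'i \<Rightarrow> 'a measure" and f :: "'i \<Rightarrow> 'a \<Rightarrow> ereal"
  assumes "ultrafilter_on I U"
    and "\<And>i. i \<in> I \<Longrightarrow> prob_space (M i)"
    and "\<And>i. i \<in> I \<Longrightarrow> f i \<in> borel_measurable (M i)"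
    and "\<exists>\<rho>\<in>majorants. (\<forall>i\<in>I. f i \<in> C_space \<rho> (M i)) \<and> (SUP i\<in>I. C_norm \<rho> (M i) (f i)) < \<infinity>"
  shows "ulim_fun U f \<in> L1_space (ulim_measure U I M) \<and>
         ereal_integral (ulim_measure U I M) (ulim_fun U f) =
           Lim U (\<lambda>i. ereal_integral (M i) (f i))"
proof -
  interpret prob_ultraproduct U I M
    using assms(1,2) by (rule prob_ultraproduct.intro)
  define \<nu> where "\<nu> = ulim_measure U I M"
  define g where "g = ulim_fun U f"
  have g [measurable]: "g \<in> borel_measurable \<nu>"
    unfolding g_def \<nu>_def by (rule ulim_fun_measurable[OF assms(3)])
  obtain \<rho> where \<rho>: "\<rho> \<in> majorants" and fin: "(SUP i\<in>I. C_norm \<rho> (M i) (f i)) < \<infinity>"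
    using assms(4) by blast
  obtain C where C: "0 \<le> C" "(SUP i\<in>I. C_norm \<rho> (M i) (f i)) = ennreal C"
    using fin by (cases "SUP i\<in>I. C_norm \<rho> (M i) (f i)") auto
  have norm: "C_norm \<rho> (M i) (f i) \<le> ennreal C" if "i \<in> I" for i
    unfolding C(2)[symmetric] using that by (rule SUP_upper)
  have tail: "\<exists>K::nat. \<forall>i\<in>I. (\<integral>\<^sup>+x. e2ennreal \<bar>f i x\<bar> - of_nat K \<partial>M i) \<le> ennreal e"
    if e: "0 < e" for e :: real
  proof -
    obtain K :: nat where "\<And>M' f'. prob_space M' \<Longrightarrow> f' \<in> borel_measurable M' \<Longrightarrow>
        C_norm \<rho> M' f' \<le> ennreal C \<Longrightarrow>
        (\<integral>\<^sup>+x. e2ennreal \<bar>f' x\<bar> - of_nat K \<partial>(M' :: 'a measure)) \<le> ennreal e"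
      using C_norm_tail[OF \<rho> e C(1)] by blast
    then show ?thesis using norm assms(2,3) by blast
  qed
  \<comment> \<open>Used for \<open>T\<close> the absolute value, the identity and the negation.\<close>
  have lim: "((\<lambda>i. \<integral>\<^sup>+x. e2ennreal (T (f i x)) \<partial>M i) \<longlongrightarrow> (\<integral>\<^sup>+c. e2ennreal (T (g c)) \<partial>\<nu>)) U"
    if T: "\<And>t. T t \<le> \<bar>t\<bar>" "T \<in> borel_measurable borel"
      "\<And>F (l::ereal). (F \<longlongrightarrow> l) U \<Longrightarrow> ((\<lambda>i. T (F i)) \<longlongrightarrow> T l) U" for T :: "ereal \<Rightarrow> ereal"
    unfolding \<nu>_def
  proof (rule nn_integral_ulim)
    show "(\<lambda>c. e2ennreal (T (g c))) \<in> borel_measurable (ulim_measure U I M)"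
      using T(2) g unfolding \<nu>_def by measurable
    show "(\<lambda>x. e2ennreal (T (f i x))) \<in> borel_measurable (M i)" if "i \<in> I" for i
      using T(2) assms(3)[OF that] by measurable
    show "((\<lambda>i. e2ennreal (T (f i (x i)))) \<longlongrightarrow> e2ennreal (T (g (cls x)))) U" if "x \<in> points" for x
      unfolding g_def by (intro tendsto_e2ennrealI T(3) ulim_fun_tendsto that)
    fix e :: real assume "0 < e"
    then obtain K :: nat where
      K: "\<And>i. i \<in> I \<Longrightarrow> (\<integral>\<^sup>+x. e2ennreal \<bar>f i x\<bar> - of_nat K \<partial>M i) \<le> ennreal e"
      using tail by meson
    have "(\<integral>\<^sup>+x. e2ennreal (T (f i x)) - of_nat K \<partial>M i) \<le> ennreal e" if "i \<in> I" for i
      by (rule order_trans[OF nn_integral_mono K[OF that]])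
        (intro ennreal_minus_mono e2ennreal_mono T(1) order_refl)
    then show "\<exists>K::nat. \<forall>i\<in>I. (\<integral>\<^sup>+x. e2ennreal (T (f i x)) - of_nat K \<partial>M i) \<le> ennreal e"
      by blast
  qed
  have "((\<lambda>i. \<integral>\<^sup>+x. e2ennreal \<bar>f i x\<bar> \<partial>M i) \<longlongrightarrow> (\<integral>\<^sup>+c. e2ennreal \<bar>g c\<bar> \<partial>\<nu>)) U"
    by (rule lim) (auto intro: tendsto_abs_ereal)
  then have abs_le: "(\<integral>\<^sup>+c. e2ennreal \<bar>g c\<bar> \<partial>\<nu>) \<le> ennreal C"
    by (rule tendsto_upperbound[OF _ eventually_mono[OF ev_I] not_bot])
      (rule C_norm_nn_integral_le[OF assms(2) \<rho> norm])
  have le_abs: "t \<le> \<bar>t\<bar>" for t :: ereal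
    by (cases t) auto
  have minus_le_abs: "- t \<le> \<bar>t\<bar>" for t :: ereal
    by (cases t) auto
  have pos_le: "(\<integral>\<^sup>+c. e2ennreal (g c) \<partial>\<nu>) \<le> ennreal C"
    by (rule order_trans[OF nn_integral_mono abs_le]) (intro e2ennreal_mono le_abs)
  have neg_le: "(\<integral>\<^sup>+c. e2ennreal (- g c) \<partial>\<nu>) \<le> ennreal C"
    by (rule order_trans[OF nn_integral_mono abs_le]) (intro e2ennreal_mono minus_le_abs)
  have "((\<lambda>i. ereal_integral (M i) (f i)) \<longlongrightarrow> ereal_integral \<nu> g) U"
    unfolding ereal_integral_def
  proof (rule tendsto_diff_ereal)
    show "((\<lambda>i. enn2ereal (\<integral>\<^sup>+x. e2ennreal (f i x) \<partial>M i)) \<longlongrightarrow>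
        enn2ereal (\<integral>\<^sup>+c. e2ennreal (g c) \<partial>\<nu>)) U"
      by (intro tendsto_enn2erealI lim[of "\<lambda>t. t"]) (auto intro: le_abs)
    show "((\<lambda>i. enn2ereal (\<integral>\<^sup>+x. e2ennreal (- f i x) \<partial>M i)) \<longlongrightarrow>
        enn2ereal (\<integral>\<^sup>+c. e2ennreal (- g c) \<partial>\<nu>)) U"
      by (intro tendsto_enn2erealI lim[of uminus]) (auto intro: minus_le_abs)
  qed (use pos_le neg_le in \<open>auto simp: top_unique\<close>)
  then have "Lim U (\<lambda>i. ereal_integral (M i) (f i)) = ereal_integral \<nu> g" by (rule Lim_eqI)
  moreover have "g \<in> L1_space \<nu>"
    using abs_le g by (auto simp: L1_space_def intro: le_less_trans)
  ultimately show ?thesis by (simp add: g_def \<nu>_def)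
qed

end
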